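(* Let $0<\alpha<1$ and let $p_1,\dots,p_n$ be $p$-values with arbitrary joint distribution, of which $n_0$ are null, and put $\pi_0=n_0/n$. Then the false discovery rate $\mathrm{FDR}$ of the BH procedure at level $\alpha$ applied to $p_1,\dots,p_n$ satisfies $$\mathrm{FDR}\;\le\;\pi_0\alpha+\pi_0\alpha\int_{\pi_0\alpha}^{1}\frac{\mathrm{FDR}_0(x)}{x^2}\,dx,$$ where $\mathrm{FDR}_0(x)$ denotes the false discovery rate of the BH procedure at level $x$ applied to the $n_0$ null $p$-values only.
   Context: The $p$-values $p_1,\dots,p_n$ are random variables with values in $[0,1]$ on a common probability space. A fixed subset $\mathcal N_0\subset\{1,\dots,n\}$ of size $n_0\ge 1$ indexes the true null hypotheses; the corresponding $p$-values are called null $p$-values, and each of them is stochastically larger than or equal to the uniform variable on $(0,1)$. BH procedure at level $\alpha$: with ordered $p$-values $p_{(1)}\le\cdots\le p_{(n)}$, let $R=\max\{1\le j\le n: p_{(j)}\le \alpha j/n\}$, with $\max\emptyset=0$; the procedure rejects the $R$ hypotheses whose $p$-values satisfy $p_j\le\alpha R/n$ (none if $R=0$). With $R$ the number of rejections and $V$ the number of rejected null $p$-values, $\mathrm{FDR}=\mathbb E[V/\max\{R,1\}]$. $\mathrm{FDR}_0(x)$, $0<x<1$: the FDR of the BH procedure at level $x$ applied to the $n_0$ null $p$-values alone, i.e. with critical values $xj/n_0$, $j=1,\dots,n_0$. *)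

theory Defs
  imports "HOL-Probability.Probability"
begin

definition stoch_le :: "real measure \<Rightarrow> real measure \<Rightarrow> bool" where
  "stoch_le \<mu> \<nu> \<longleftrightarrow> (\<forall>t. measure \<mu> {t<..} \<le> measure \<nu> {t<..})"

definition null_pvalue :: "'a measure \<Rightarrow> ('a \<Rightarrow> real) \<Rightarrow> bool" where
  "null_pvalue M X \<longleftrightarrow> stoch_le (uniform_measure lborel {0<..<1}) (distr M borel X)"

text \<open>The \<open>j\<close>-th smallest of the values \<open>q i\<close>, \<open>i \<in> I\<close>, counted with multiplicity;
  only used for \<open>1 \<le> j \<le> card I\<close>.\<close>

definition ordered_pvalue :: "'i set \<Rightarrow> ('i \<Rightarrow> real) \<Rightarrow> nat \<Rightarrow> real" where
  "ordered_pvalue I q j = sorted_list_of_multiset (image_mset q (mset_set I)) ! (j - 1)"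

definition BH_number :: "real \<Rightarrow> 'i set \<Rightarrow> ('i \<Rightarrow> real) \<Rightarrow> nat" where
  "BH_number \<alpha> I q =
     Max (insert 0 {j \<in> {1..card I}. ordered_pvalue I q j \<le> \<alpha> * real j / real (card I)})"

definition BH_rejected :: "real \<Rightarrow> 'i set \<Rightarrow> ('i \<Rightarrow> real) \<Rightarrow> 'i set" where
  "BH_rejected \<alpha> I q =
     (if BH_number \<alpha> I q = 0 then {}
      else {i \<in> I. q i \<le> \<alpha> * real (BH_number \<alpha> I q) / real (card I)})"

text \<open>False discovery rate at level \<open>\<alpha>\<close> of the BH procedure applied to the p-values
  \<open>p i\<close>, \<open>i \<in> I\<close>, when \<open>N\<close> is the set of true nulls.\<close>

definition FDR :: "'a measure \<Rightarrow> ('i \<Rightarrow> 'a \<Rightarrow> real) \<Rightarrow> 'i set \<Rightarrow> 'i set \<Rightarrow> real \<Rightarrow> real" where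
  "FDR M p I N \<alpha> =
     (LINT \<omega>|M. real (card (BH_rejected \<alpha> I (\<lambda>i. p i \<omega>) \<inter> N))
                / real (max (card (BH_rejected \<alpha> I (\<lambda>i. p i \<omega>))) 1))"

definition FDR\<^sub>0 :: "'a measure \<Rightarrow> ('i \<Rightarrow> 'a \<Rightarrow> real) \<Rightarrow> 'i set \<Rightarrow> real \<Rightarrow> real" where
  "FDR\<^sub>0 M p N x = FDR M p N N x"

end

theory Submission
  imports Defs
begin

text \<open>Let \<open>c = \<pi>\<^sub>0 * \<alpha>\<close>. If the BH procedure at level \<open>\<alpha>\<close> makes \<open>R\<close> rejections, \<open>V > 0\<close> of them
  false, then \<open>V\<close> null p-values are at most \<open>\<alpha> * R / n\<close>, so the BH procedure on the null
  p-values alone rejects at every level \<open>x \<ge> y\<close>, where \<open>y = c * R / V\<close>. Since \<open>c / y = c + c * (1 / y - 1)\<close>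
  and \<open>1 / y - 1\<close> is the integral of \<open>1 / x\<^sup>2\<close> over \<open>(y, 1)\<close>, the false discovery proportion \<open>V / R = c / y\<close>
  is pointwise at most \<open>c\<close> plus \<open>c\<close> times the integral over \<open>(c, 1)\<close> of \<open>1 / x\<^sup>2\<close> restricted to the levels \<open>x\<close>
  with a null rejection. When all hypotheses are null the FDR is the probability of a
  rejection, so taking expectations and exchanging the integrals gives the bound.\<close>

section \<open>Counting description of the BH procedure\<close>

text \<open>In a sorted list the entries at most \<open>t\<close> form an initial segment, so its
  length decides which positions belong to it.\<close>

lemma sorted_nth_le_iff:
  fixes xs :: "'a::linorder list"
  assumes "sorted xs" "k < length xs"
  shows "xs ! k \<le> t \<longleftrightarrow> k < length (filter (\<lambda>x. x \<le> t) xs)"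
  using assms
proof (induction xs arbitrary: k)
  case (Cons x xs)
  show ?case
  proof (cases "x \<le> t")
    case True
    with Cons show ?thesis by (cases k) auto
  next
    case False
    then have "\<forall>y\<in>set (x # xs). \<not> y \<le> t"
      using Cons.prems by force
    then show ?thesis
      by (metis Cons.prems(2) filter_False list.size(3) not_less_zero nth_mem)
  qed
qed simp

lemma ordered_pvalue_le_iff:
  assumes "finite I" "1 \<le> j" "j \<le> card I"
  shows "ordered_pvalue I q j \<le> t \<longleftrightarrow> j \<le> card {i \<in> I. q i \<le> t}"
proof -
  define xs where "xs = sorted_list_of_multiset (image_mset q (mset_set I))"
  have mset: "mset xs = image_mset q (mset_set I)"
    by (simp add: xs_def)
  have "length xs = card I"
    by (metis mset size_mset size_image_mset size_mset_set)
  moreover have "length (filter (\<lambda>x. x \<le> t) xs) = card {i \<in> I. q i \<le> t}"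
  proof -
    have "length (filter (\<lambda>x. x \<le> t) xs) = size (filter_mset (\<lambda>x. x \<le> t) (mset xs))"
      by (metis mset_filter size_mset)
    also have "\<dots> = card {i \<in> I. q i \<le> t}"
      using \<open>finite I\<close> by (simp add: mset filter_mset_image_mset filter_mset_mset_set)
    finally show ?thesis .
  qed
  moreover have "sorted xs"
    by (simp add: xs_def sorted_sorted_list_of_multiset)
  ultimately show ?thesis
    \<comment> \<open>Positions start at 0, and \<open>1 \<le> j\<close> turns
      \<open>j - 1 < m\<close> into \<open>j \<le> m\<close>.\<close>
    using sorted_nth_le_iff[of xs "j - 1" t] assms by (auto simp: ordered_pvalue_def xs_def[symmetric])
qed

lemma BH_number_eq:
  assumes "finite I"
  shows "BH_number \<alpha> I q =
    Max (insert 0 {j \<in> {1..card I}. j \<le> card {i \<in> I. q i \<le> \<alpha> * real j / real (card I)}})"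
proof -
  have "{j \<in> {1..card I}. ordered_pvalue I q j \<le> \<alpha> * real j / real (card I)} =
      {j \<in> {1..card I}. j \<le> card {i \<in> I. q i \<le> \<alpha> * real j / real (card I)}}"
    using ordered_pvalue_le_iff[OF assms] by auto
  then show ?thesis
    by (simp add: BH_number_def)
qed

lemma BH_number_cases:
  assumes "finite I"
  obtains "BH_number \<alpha> I q = 0"
  | "BH_number \<alpha> I q \<in> {1..card I}"
    "BH_number \<alpha> I q \<le> card {i \<in> I. q i \<le> \<alpha> * real (BH_number \<alpha> I q) / real (card I)}"
proof -
  have "BH_number \<alpha> I q
      \<in> insert 0 {j \<in> {1..card I}. j \<le> card {i \<in> I. q i \<le> \<alpha> * real j / real (card I)}}"
    unfolding BH_number_eq[OF assms] by (rule Max_in) auto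
  then show thesis
    using that by auto
qed

text \<open>Any single index meeting its critical value forces a rejection, so the maximum need not
  be known. This serves both measurability and the exhibition of a rejection.\<close>

lemma BH_rejected_nonempty_iff:
  assumes "finite I"
  shows "BH_rejected \<alpha> I q \<noteq> {} \<longleftrightarrow>
    (\<exists>j\<in>{1..card I}. j \<le> card {i \<in> I. q i \<le> \<alpha> * real j / real (card I)})"
    (is "_ \<longleftrightarrow> ?E")
proof
  assume "BH_rejected \<alpha> I q \<noteq> {}"
  then have "BH_number \<alpha> I q \<noteq> 0"
    by (auto simp: BH_rejected_def)
  with assms show ?E
    by (metis BH_number_cases)
next
  assume ?E
  then obtain j where j: "j \<in> {1..card I}" "j \<le> card {i \<in> I. q i \<le> \<alpha> * real j / real (card I)}"
    by blast
  then have "j \<le> BH_number \<alpha> I q"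
    unfolding BH_number_eq[OF assms] by (intro Max_ge) auto
  with j have ne: "BH_number \<alpha> I q \<noteq> 0"
    by auto
  with assms have "BH_number \<alpha> I q \<le> card {i \<in> I. q i \<le> \<alpha> * real (BH_number \<alpha> I q) / real (card I)}"
    by (metis BH_number_cases)
  with ne have "{i \<in> I. q i \<le> \<alpha> * real (BH_number \<alpha> I q) / real (card I)} \<noteq> {}"
    by (metis card.empty le_zero_eq)
  with ne show "BH_rejected \<alpha> I q \<noteq> {}"
    by (simp add: BH_rejected_def)
qed

text \<open>Every rejection among nulls is false, so the proportion is 1 unless nothing is rejected,
  when it is 0.\<close>

lemma FDR\<^sub>0_eq:
  assumes "finite N"
  shows "FDR\<^sub>0 M p N x = (LINT \<omega>|M. of_bool (BH_rejected x N (\<lambda>i. p i \<omega>) \<noteq> {}))"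
proof -
  have "real (card (A \<inter> N)) / real (max (card A) 1) = of_bool (A \<noteq> {})" if "A \<subseteq> N" for A
  proof -
    have "finite A" "A \<inter> N = A"
      using that assms by (auto intro: finite_subset)
    then show ?thesis
      using card_gt_0_iff[of A] by (cases "A = {}") (auto simp: max_absorb1 Suc_le_eq)
  qed
  moreover have "BH_rejected x N q \<subseteq> N" for q
    by (auto simp: BH_rejected_def)
  ultimately show ?thesis
    by (simp add: FDR\<^sub>0_def FDR_def)
qed

section \<open>Integration against the inverse square, and measurability in the level\<close>

lemma set_integral_inverse_square:
  fixes a b :: real
  assumes "0 < a" "a \<le> b"
  shows "(LBINT x:{a<..<b}. 1 / x\<^sup>2) = 1 / a - 1 / b"
proof -
  have "(LBINT x=a..b. 1 / x\<^sup>2) = - (1 / b) - (- (1 / a))"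
  proof (rule interval_integral_FTC_finite)
    show "continuous_on {min a b..max a b} (\<lambda>x. 1 / x\<^sup>2)"
      using assms by (intro continuous_intros) auto
    show "((\<lambda>x. - (1 / x)) has_vector_derivative 1 / x\<^sup>2) (at x within {min a b..max a b})"
      if "min a b \<le> x" "x \<le> max a b" for x
      using that assms unfolding has_real_derivative_iff_has_vector_derivative[symmetric]
      by (auto intro!: derivative_eq_intros simp: power2_eq_square)
  qed
  then show ?thesis
    using assms by (simp add: interval_lebesgue_integral_def)
qed

lemma indicator_divide_square_le:
  fixes c x y :: real
  assumes "0 < c" "\<bar>y\<bar> \<le> 1"
  shows "norm (indicator {c<..<1} x *\<^sub>R (y / x\<^sup>2)) \<le> 1 / c\<^sup>2"
proof (cases "x \<in> {c<..<1}")
  case True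
  then have "\<bar>y\<bar> / x\<^sup>2 \<le> 1 / c\<^sup>2"
    using assms by (intro frac_le power_mono) auto
  with True show ?thesis
    by simp
qed (use assms in simp)

lemma set_integrable_bounded_inverse_square:
  fixes c :: real and f :: "real \<Rightarrow> real"
  assumes "0 < c" and [measurable]: "f \<in> borel_measurable borel" and "\<And>x. \<bar>f x\<bar> \<le> 1"
  shows "set_integrable lborel {c<..<1} (\<lambda>x. f x / x\<^sup>2)"
  unfolding set_integrable_def
proof (rule integrableI_bounded_set[where A = "{c<..<1}" and B = "1 / c\<^sup>2"])
  show "emeasure lborel {c<..<1} < \<infinity>"
    \<comment> \<open>For \<open>c > 1\<close> the interval is empty.\<close>
    by (cases "c \<le> 1") auto
  show "AE x in lborel. x \<in> {c<..<1} \<longrightarrow> norm (indicator {c<..<1} x *\<^sub>R (f x / x\<^sup>2)) \<le> 1 / c\<^sup>2"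
    using indicator_divide_square_le[OF assms(1,3)] by blast
qed auto

text \<open>Joint measurability in level and outcome, as the exchange of integrals requires.\<close>

lemma BH_rejected_nonempty_measurable:
  assumes "finite N" and [measurable]: "\<And>i. i \<in> N \<Longrightarrow> p i \<in> borel_measurable M"
  shows "(\<lambda>(x, \<omega>). of_bool (BH_rejected x N (\<lambda>i. p i \<omega>) \<noteq> {}) :: real)
    \<in> borel_measurable (borel \<Otimes>\<^sub>M M)"
proof -
  \<comment> \<open>Counts become finite sums of indicators, which are visibly measurable.\<close>
  have "j \<le> card {i \<in> N. P i} \<longleftrightarrow> real j \<le> (\<Sum>i\<in>N. of_bool (P i))" for P j
    using \<open>finite N\<close> by (simp add: of_bool_def sum.If_cases Int_def)
  then have "(\<lambda>(x, \<omega>). of_bool (BH_rejected x N (\<lambda>i. p i \<omega>) \<noteq> {}) :: real) =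
      (\<lambda>z. of_bool (\<exists>j\<in>{1..card N}.
        real j \<le> (\<Sum>i\<in>N. of_bool (p i (snd z) \<le> fst z * real j / real (card N)))))"
    unfolding BH_rejected_nonempty_iff[OF \<open>finite N\<close>]
    by (simp add: case_prod_beta')
  moreover have "\<dots> \<in> borel_measurable (borel \<Otimes>\<^sub>M M)"
    by measurable
  ultimately show ?thesis
    by simp
qed

section \<open>Pointwise bound on the false discovery proportion\<close>

text \<open>All \<open>V\<close> rejected nulls are at most \<open>\<alpha> * R / card I\<close>.
  Hypothesis \<open>x\<close> is the cross-multiplied form of the level condition; it bounds this by
  the \<open>V\<close>-th critical value at level \<open>x\<close> on \<open>N\<close>, so
  \<open>j = V\<close> witnesses a rejection.\<close>

lemma BH_rejected_nonempty_of_subset: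
  fixes q :: "'i \<Rightarrow> real" and \<alpha> x :: real
  assumes "finite I" "N \<subseteq> I" "BH_rejected \<alpha> I q \<inter> N \<noteq> {}"
    and x: "card N * \<alpha> * BH_number \<alpha> I q \<le> card I * x * card (BH_rejected \<alpha> I q \<inter> N)"
  shows "BH_rejected x N q \<noteq> {}"
proof -
  define R V where "R = BH_number \<alpha> I q" and "V = card (BH_rejected \<alpha> I q \<inter> N)"
  have [simp]: "finite N"
    using assms finite_subset by blast
  have V: "V \<in> {1..card N}"
    using assms(3) by (auto simp: V_def Suc_le_eq card_gt_0_iff intro: card_mono)
  have "card I > 0"
    using V assms(1,2) card_mono[of I N] by auto
  with V x have "\<alpha> * R / card I \<le> x * V / card N"
    by (simp add: field_simps R_def V_def)
  then have "BH_rejected \<alpha> I q \<inter> N \<subseteq> {i \<in> N. q i \<le> x * V / card N}"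
    by (auto simp: BH_rejected_def R_def split: if_splits)
  then have "V \<le> card {i \<in> N. q i \<le> x * V / card N}"
    unfolding V_def by (intro card_mono) auto
  with V show ?thesis
    by (auto simp: BH_rejected_nonempty_iff)
qed

text \<open>Allows the false discovery proportion to be bounded by \<open>V / R\<close> with
  \<open>R\<close> the BH number.\<close>

lemma card_BH_rejected_ge:
  assumes "finite I"
  shows "BH_number \<alpha> I q \<le> card (BH_rejected \<alpha> I q)"
  using assms by (cases rule: BH_number_cases[of I \<alpha> q]) (auto simp: BH_rejected_def)

lemma FDP_le:
  fixes q :: "'i \<Rightarrow> real" and \<alpha> c :: real
  assumes "finite I" "N \<subseteq> I" "N \<noteq> {}" "0 < \<alpha>" and c: "c = card N / card I * \<alpha>"
  shows "card (BH_rejected \<alpha> I q \<inter> N) / max (card (BH_rejected \<alpha> I q)) 1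
    \<le> c + c * (LBINT x:{c<..<1}. of_bool (BH_rejected x N q \<noteq> {}) / x\<^sup>2)"
    (is "?FDP \<le> c + c * (LBINT x:_. ?E x / _)")
proof -
  define R V where "R = BH_number \<alpha> I q" and "V = card (BH_rejected \<alpha> I q \<inter> N)"
  have [simp]: "finite N"
    using assms finite_subset by blast
  have card: "0 < card N" "0 < card I"
    using assms by (auto simp: card_gt_0_iff)
  have "c > 0"
    using card \<open>0 < \<alpha>\<close> by (simp add: c)
  have meas: "?E \<in> borel_measurable borel"
  proof -
    \<comment> \<open>A one-point sample space reduces joint measurability to the level alone, for
      fixed \<open>q\<close>.\<close>
    have "(\<lambda>(x, _::unit). ?E x) \<in> borel_measurable (borel \<Otimes>\<^sub>M count_space UNIV)"
      by (rule BH_rejected_nonempty_measurable) simp_all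
    from measurable_Pair1[OF this, of "()"] show ?thesis
      by simp
  qed
  have int: "set_integrable lborel {c<..<1} (\<lambda>x. ?E x / x\<^sup>2)"
    using \<open>c > 0\<close> meas by (rule set_integrable_bounded_inverse_square) simp
  have nonneg: "0 \<le> (LBINT x:{c<..<1}. ?E x / x\<^sup>2)"
    by (auto simp: set_lebesgue_integral_def intro!: integral_nonneg)
  show ?thesis
  proof (cases "BH_rejected \<alpha> I q \<inter> N = {}")
    case True
    then show ?thesis
      using nonneg \<open>c > 0\<close> by simp
  next
    case False
    then have "V > 0" "R > 0"
      by (auto simp: V_def R_def card_gt_0_iff BH_rejected_def)
    define y where "y = c * R / V"
    have "y > 0"
      using \<open>V > 0\<close> \<open>R > 0\<close> \<open>c > 0\<close> by (simp add: y_def)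
    have "R \<le> card (BH_rejected \<alpha> I q)"
      unfolding R_def using \<open>finite I\<close> by (rule card_BH_rejected_ge)
    then have "?FDP \<le> V / R"
      using \<open>R > 0\<close> unfolding V_def by (intro divide_left_mono) auto
    also have "V / R = c / y"
      using \<open>V > 0\<close> \<open>R > 0\<close> \<open>c > 0\<close> by (simp add: y_def)
    finally have FDP: "?FDP \<le> c / y" .
    have "?FDP \<le> 1"
      using \<open>finite I\<close> card_mono[of "BH_rejected \<alpha> I q" "BH_rejected \<alpha> I q \<inter> N"]
      by (auto simp: BH_rejected_def max_def)
    \<comment> \<open>The bound \<open>R \<le> card (BH_rejected \<alpha> I q)\<close> alone does
      not exclude \<open>y < c\<close>. Truncating at \<open>c\<close> keeps \<open>(z, 1)\<close>
      inside \<open>(c, 1)\<close>, and \<open>?FDP \<le> 1\<close> covers the case where the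
      maximum is \<open>c\<close>.\<close>
    define z where "z = max c y"
    have "?FDP \<le> c / z"
      using FDP \<open>?FDP \<le> 1\<close> \<open>c > 0\<close> by (auto simp: z_def max_def)
    have "c \<le> z" "y \<le> z" "0 < z"
      using \<open>c > 0\<close> by (auto simp: z_def)
    have "1 / z - 1 \<le> (LBINT x:{c<..<1}. ?E x / x\<^sup>2)"
    proof (cases "z \<le> 1")
      case True
      have E: "?E x = 1" if "z < x" for x
      proof -
        have "y \<le> x"
          using that \<open>y \<le> z\<close> by simp
        then have "card N * \<alpha> * R \<le> card I * x * V"
          using card \<open>V > 0\<close> by (simp add: y_def c field_simps)
        then have "BH_rejected x N q \<noteq> {}"
          using BH_rejected_nonempty_of_subset[of I N \<alpha> q x] assms False
          by (simp add: R_def V_def)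
        then show ?thesis
          by simp
      qed
      have "1 / z - 1 = (LBINT x:{z<..<1}. 1 / x\<^sup>2)"
        using set_integral_inverse_square[of z 1] \<open>0 < z\<close> True by simp
      also have "\<dots> = (LBINT x:{z<..<1}. ?E x / x\<^sup>2)"
        using E by (intro set_lebesgue_integral_cong) auto
      also have "\<dots> \<le> (LBINT x:{c<..<1}. ?E x / x\<^sup>2)"
        unfolding set_lebesgue_integral_def
        using int \<open>c \<le> z\<close>
        by (intro integral_mono') (auto simp: set_integrable_def indicator_def)
      finally show ?thesis .
    next
      case False
      then have "1 / z - 1 \<le> 0"
        by simp
      with nonneg show ?thesis
        by linarith
    qed
    \<comment> \<open>Adding \<open>c\<close> to the left side gives \<open>c / z\<close>.\<close>
    then have "c * (1 / z - 1) \<le> c * (LBINT x:{c<..<1}. ?E x / x\<^sup>2)"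
      using \<open>c > 0\<close> by (intro mult_left_mono) auto
    with \<open>?FDP \<le> c / z\<close> show ?thesis
      by (simp add: algebra_simps)
  qed
qed

section \<open>Expectation of the pointwise bound\<close>

lemma FDR_le:
  fixes p :: "'i \<Rightarrow> 'a \<Rightarrow> real" and \<alpha> c :: real
  assumes "prob_space M" "finite I" "N \<subseteq> I" "N \<noteq> {}" "0 < \<alpha>"
    and p [measurable]: "\<And>i. i \<in> N \<Longrightarrow> p i \<in> borel_measurable M"
    and c: "c = card N / card I * \<alpha>"
  shows "FDR M p I N \<alpha> \<le> c + c * (LBINT x:{c<..<1}. FDR\<^sub>0 M p N x / x\<^sup>2)"
proof -
  interpret M: prob_space M by fact
  interpret pair_sigma_finite lborel M ..
  \<comment> \<open>The indicator is built into \<open>f\<close>, so that it is bounded by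
    \<open>1 / c\<^sup>2\<close> and vanishes off a strip of finite product measure.\<close>
  define f where "f = (\<lambda>x \<omega>. indicat_real {c<..<1} x *\<^sub>R
    (of_bool (BH_rejected x N (\<lambda>i. p i \<omega>) \<noteq> {}) / x\<^sup>2))"
  have [simp]: "finite N"
    using assms finite_subset by blast
  have "0 < card N" "0 < card I"
    using assms by (auto simp: card_gt_0_iff)
  then have "c > 0"
    using \<open>0 < \<alpha>\<close> by (simp add: c)
  have f_nonneg: "0 \<le> f x \<omega>" for x \<omega>
    by (simp add: f_def)
  have int: "integrable (lborel \<Otimes>\<^sub>M M) (\<lambda>(x, \<omega>). f x \<omega>)"
  proof (rule integrableI_bounded_set[where A = "{c<..<1} \<times> space M" and B = "1 / c\<^sup>2"])
    have [measurable]: "(\<lambda>(x, \<omega>). of_bool (BH_rejected x N (\<lambda>i. p i \<omega>) \<noteq> {}) :: real)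
        \<in> borel_measurable (lborel \<Otimes>\<^sub>M M)"
      using BH_rejected_nonempty_measurable[OF \<open>finite N\<close> p]
      \<comment> \<open>\<open>lborel\<close> and \<open>borel\<close> have the same measurable
        sets.\<close>
      by (simp only: measurable_cong_sets[OF sets_pair_measure_cong[OF sets_lborel refl] refl])
    have "(\<lambda>z. indicat_real {c<..<1} (fst z) *\<^sub>R
        ((case z of (x, \<omega>) \<Rightarrow> of_bool (BH_rejected x N (\<lambda>i. p i \<omega>) \<noteq> {})) / (fst z)\<^sup>2))
        \<in> borel_measurable (lborel \<Otimes>\<^sub>M M)"
      by measurable
    then show "(\<lambda>(x, \<omega>). f x \<omega>) \<in> borel_measurable (lborel \<Otimes>\<^sub>M M)"
      by (simp add: f_def case_prod_beta')
    show "emeasure (lborel \<Otimes>\<^sub>M M) ({c<..<1} \<times> space M) < \<infinity>"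
      by (subst M.emeasure_pair_measure_Times) (cases "c \<le> 1"; auto simp: M.emeasure_space_1)+
    have "norm (f x \<omega>) \<le> 1 / c\<^sup>2" for x \<omega>
      unfolding f_def using \<open>c > 0\<close> by (intro indicator_divide_square_le) auto
    then show "AE z in lborel \<Otimes>\<^sub>M M. z \<in> {c<..<1} \<times> space M \<longrightarrow>
        norm (case z of (x, \<omega>) \<Rightarrow> f x \<omega>) \<le> 1 / c\<^sup>2"
      by (intro AE_I2) auto
    show "AE z in lborel \<Otimes>\<^sub>M M. z \<notin> {c<..<1} \<times> space M \<longrightarrow>
        (case z of (x, \<omega>) \<Rightarrow> f x \<omega>) = 0"
      by (intro AE_I2) (auto simp: f_def space_pair_measure indicator_def split: if_splits)
  qed auto
  have "FDR M p I N \<alpha> \<le> (LINT \<omega>|M. c + c * (LBINT x. f x \<omega>))"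
    unfolding FDR_def
  \<comment> \<open>Only the dominating function has to be integrable, so the FDP need not be shown measurable.\<close>
  proof (rule integral_mono')
    show "integrable M (\<lambda>\<omega>. c + c * (LBINT x. f x \<omega>))"
      using integrable_snd[OF int] by simp
    show "0 \<le> c + c * (LBINT x. f x \<omega>)" for \<omega>
      using \<open>c > 0\<close> f_nonneg by (simp add: integral_nonneg)
    show "card (BH_rejected \<alpha> I (\<lambda>i. p i \<omega>) \<inter> N) / max (card (BH_rejected \<alpha> I (\<lambda>i. p i \<omega>))) 1
        \<le> c + c * (LBINT x. f x \<omega>)" for \<omega>
      using FDP_le[of I N \<alpha> c "\<lambda>i. p i \<omega>"] assms
      by (simp add: f_def set_lebesgue_integral_def)
  qed
  also have "\<dots> = c + c * (LINT \<omega>|M. (LBINT x. f x \<omega>))"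
    using integrable_snd[OF int] by (simp add: M.prob_space)
  also have "(LINT \<omega>|M. (LBINT x. f x \<omega>)) = (LBINT x. (LINT \<omega>|M. f x \<omega>))"
    using int by (rule Fubini_integral)
  also have "\<dots> = (LBINT x:{c<..<1}. FDR\<^sub>0 M p N x / x\<^sup>2)"
    by (simp add: f_def FDR\<^sub>0_eq set_lebesgue_integral_def)
  finally show ?thesis .
qed

theorem theorem1:
  fixes M :: "'a measure" and p :: "nat \<Rightarrow> 'a \<Rightarrow> real" and n n\<^sub>0 :: nat
    and N\<^sub>0 :: "nat set" and \<alpha> \<pi>\<^sub>0 :: real
  assumes "prob_space M"
    and "0 < \<alpha>" and "\<alpha> < 1"
    and "\<And>i. i \<in> {1..n} \<Longrightarrow> p i \<in> borel_measurable M"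
    and "\<And>i \<omega>. i \<in> {1..n} \<Longrightarrow> \<omega> \<in> space M \<Longrightarrow> p i \<omega> \<in> {0..1}"
    and "N\<^sub>0 \<subseteq> {1..n}" and "n\<^sub>0 = card N\<^sub>0" and "n\<^sub>0 \<ge> 1"
    and "\<And>i. i \<in> N\<^sub>0 \<Longrightarrow> null_pvalue M (p i)"
    and "\<pi>\<^sub>0 = real n\<^sub>0 / real n"
  shows "FDR M p {1..n} N\<^sub>0 \<alpha>
    \<le> \<pi>\<^sub>0 * \<alpha> + \<pi>\<^sub>0 * \<alpha> * (LBINT x=\<pi>\<^sub>0 * \<alpha>..1. FDR\<^sub>0 M p N\<^sub>0 x / x\<^sup>2)"
proof -
  have "n\<^sub>0 \<le> n"
    using assms(6,7) card_mono[of "{1..n}" N\<^sub>0] by simp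
  \<comment> \<open>This orders the endpoints; in the reverse order the interval integral would
    carry a minus sign.\<close>
  then have "\<pi>\<^sub>0 * \<alpha> \<le> 1"
    using assms by (intro mult_le_one) auto
  then have "(LBINT x=\<pi>\<^sub>0 * \<alpha>..1. FDR\<^sub>0 M p N\<^sub>0 x / x\<^sup>2) =
      (LBINT x:{\<pi>\<^sub>0 * \<alpha><..<1}. FDR\<^sub>0 M p N\<^sub>0 x / x\<^sup>2)"
    by (simp add: interval_lebesgue_integral_def one_ereal_def del: ereal_eq_1 times_ereal.simps)
  moreover have "N\<^sub>0 \<noteq> {}"
    using assms by auto
  ultimately show ?thesis
    using FDR_le[of M "{1..n}" N\<^sub>0 \<alpha> p "\<pi>\<^sub>0 * \<alpha>"] assms(1,2,4,6,7,10)
    by (simp add: subset_iff)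
qed

end
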